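(* Let $(W,S)$ be a Coxeter system of type $A_n$, $n\ge 1$. Then, for all $0\le j,k\le n$, $$x_j\,x_k=\sum_{l=-1}^{\min(j,k)}\binom{n-j}{k-l}\binom{n-k}{j-l}(n-j-k+l)!\,x_l ,$$ where $x_{-1}:=x_0$.
   Context: For a finite Coxeter system $(W,S)$ with length function $\ell$ and $J\subseteq S$, let $X_J=\{w\in W: \ell(ws)>\ell(w)\text{ for all } s\in J\}$ and $x_J=\sum_{w\in X_J} w$ in the group algebra $\mathbb{Q}W$. For type $A_n$ label $S=\{s_1,\dots,s_n\}$ so that $s_is_{i+1}$ has order $3$ for $1\le i\le n-1$ and all other pairs of distinct generators commute. For $0\le j\le n$ put $x_j=x_{\{s_1,\dots,s_j\}}$ (so $x_n=1$ and $x_0=\sum_{w\in W}w$). Convention: terms with $n-j-k+l<0$ are zero (then $k-l>n-j$ and $j-l>n-k$, so both binomial coefficients vanish). *)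

theory Defs
  imports "HOL-Algebra.Algebra" "HOL-Library.Poly_Mapping"
begin

(* Equality of words in the group presented by generators S and relations (s t)^(m s t) = 1 for
   s, t in S, where m s t = 0 encodes "no relation" (infinite order).  The intended m satisfies
   m s s = 1, so that s^2 = 1 is among the relations; every generator is then its own inverse,
   formal inverses are redundant, and words over S with this congruence form the
   presented group. *)
inductive coxeter_word_eq :: "'a set \<Rightarrow> ('a \<Rightarrow> 'a \<Rightarrow> nat) \<Rightarrow> 'a list \<Rightarrow> 'a list \<Rightarrow> bool"
  for S :: "'a set" and m :: "'a \<Rightarrow> 'a \<Rightarrow> nat" where
  refl: "set u \<subseteq> S \<Longrightarrow> coxeter_word_eq S m u u"
| sym: "coxeter_word_eq S m u v \<Longrightarrow> coxeter_word_eq S m v u"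
| trans: "coxeter_word_eq S m u v \<Longrightarrow> coxeter_word_eq S m v w \<Longrightarrow> coxeter_word_eq S m u w"
| relation: "\<lbrakk>set u \<subseteq> S; set v \<subseteq> S; s \<in> S; t \<in> S\<rbrakk> \<Longrightarrow>
    coxeter_word_eq S m (u @ concat (replicate (m s t) [s, t]) @ v) (u @ v)"

definition word_prod :: "('a, 'b) monoid_scheme \<Rightarrow> 'a list \<Rightarrow> 'a" where
  "word_prod W us = foldr (\<lambda>s w. s \<otimes>\<^bsub>W\<^esub> w) us \<one>\<^bsub>W\<^esub>"

(* W is generated by the involutions in S, and the relations (s t)^(order of s t) = 1
   present W: words with the same product in W are equal modulo these relations.
   The library's ord is 0 on elements of infinite order, which then impose no relation. *)
locale coxeter_system = group W for W (structure) +
  fixes S :: "'a set"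
  assumes gens_in_carrier: "S \<subseteq> carrier W"
    and gens_involutions: "\<And>s. s \<in> S \<Longrightarrow> ord s = 2"
    and generated: "generate W S = carrier W"
    and presented: "\<And>u v. \<lbrakk>set u \<subseteq> S; set v \<subseteq> S; word_prod W u = word_prod W v\<rbrakk> \<Longrightarrow>
          coxeter_word_eq S (\<lambda>s t. ord (s \<otimes> t)) u v"

locale coxeter_system_type_A = coxeter_system W S for W (structure) and S +
  fixes s :: "nat \<Rightarrow> 'a" and n :: nat
  assumes labelling: "bij_betw s {1..n} S"
    and adjacent: "\<And>i. \<lbrakk>1 \<le> i; i < n\<rbrakk> \<Longrightarrow> ord (s i \<otimes> s (i + 1)) = 3"
    and nonadjacent: "\<And>i j. \<lbrakk>i \<in> {1..n}; j \<in> {1..n}; i \<noteq> j; j \<noteq> i + 1; i \<noteq> j + 1\<rbrakk> \<Longrightarrow>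
          s i \<otimes> s j = s j \<otimes> s i"

definition cox_length :: "('a, 'b) monoid_scheme \<Rightarrow> 'a set \<Rightarrow> 'a \<Rightarrow> nat" where
  "cox_length W S w = (LEAST r. \<exists>us. set us \<subseteq> S \<and> length us = r \<and> word_prod W us = w)"

definition X_set :: "('a, 'b) monoid_scheme \<Rightarrow> 'a set \<Rightarrow> 'a set \<Rightarrow> 'a set" where
  "X_set W S J = {w \<in> carrier W. \<forall>s\<in>J. cox_length W S (w \<otimes>\<^bsub>W\<^esub> s) > cox_length W S w}"

(* The rational group algebra of W consists of the f :: 'a \<Rightarrow>\<^sub>0 rat with keys f \<subseteq> carrier W;
   group elements are the w with coefficient 1, addition is that of the type, and
   multiplication is the bilinear extension of the product of W.  (The product * of the
   library's type refers to a type-class monoid and is not the one meant here.) *)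
definition ga_elem :: "'a \<Rightarrow> ('a \<Rightarrow>\<^sub>0 rat)" where
  "ga_elem w = Poly_Mapping.single w 1"

definition ga_scale :: "rat \<Rightarrow> ('a \<Rightarrow>\<^sub>0 rat) \<Rightarrow> ('a \<Rightarrow>\<^sub>0 rat)" where
  "ga_scale c f = Poly_Mapping.map (\<lambda>a. c * a) f"

definition ga_mult :: "('a, 'b) monoid_scheme \<Rightarrow> ('a \<Rightarrow>\<^sub>0 rat) \<Rightarrow> ('a \<Rightarrow>\<^sub>0 rat) \<Rightarrow> ('a \<Rightarrow>\<^sub>0 rat)" where
  "ga_mult W f g = (\<Sum>u\<in>Poly_Mapping.keys f. \<Sum>v\<in>Poly_Mapping.keys g.
     Poly_Mapping.single (u \<otimes>\<^bsub>W\<^esub> v) (Poly_Mapping.lookup f u * Poly_Mapping.lookup g v))"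

definition x_elem :: "('a, 'b) monoid_scheme \<Rightarrow> 'a set \<Rightarrow> 'a set \<Rightarrow> ('a \<Rightarrow>\<^sub>0 rat)" where
  "x_elem W S J = (\<Sum>w\<in>X_set W S J. ga_elem w)"

(* Indexed by an integer so that the convention x_(-1) = x_0 can be expressed. *)
definition x_A :: "('a, 'b) monoid_scheme \<Rightarrow> 'a set \<Rightarrow> (nat \<Rightarrow> 'a) \<Rightarrow> int \<Rightarrow> ('a \<Rightarrow>\<^sub>0 rat)" where
  "x_A W S s j = (if j = -1 then x_elem W S {} else x_elem W S (s ` {1..nat j}))"

(* The coefficient of x_l in x_j x_k; it is used for l \<le> min j k only, so that k - l and
   j - l are not negative. *)
definition coeff_A :: "nat \<Rightarrow> nat \<Rightarrow> nat \<Rightarrow> int \<Rightarrow> nat" where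
  "coeff_A n j k l =
     (if int n - int j - int k + l < 0 then 0
      else ((n - j) choose nat (int k - l)) * ((n - k) choose nat (int j - l))
           * fact (nat (int n - int j - int k + l)))"

end

theory Submission
  imports Defs "HOL-Combinatorics.Multiset_Permutations"
begin

text \<open>
  Sending \<open>s i\<close> to the transposition of \<open>i\<close> and \<open>i + 1\<close> identifies \<open>W\<close> with the symmetric group on
  \<open>{1..n + 1}\<close>.  This map is injective because a product of generators from \<open>s 1, \<dots>, s (k + 1)\<close> has the
  form \<open>h s\<^sub>k\<^sub>+\<^sub>1 s\<^sub>k \<dots> s\<^sub>i\<^sub>+\<^sub>1\<close> with \<open>h\<close> generated by \<open>s 1, \<dots>, s k\<close>: its permutation sends \<open>i + 1\<close> to \<open>k + 2\<close>,
  so if it is the identity, then \<open>i = k + 1\<close>, and induction applies to \<open>h\<close>.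
  Moreover \<open>s i\<close> is a right ascent of \<open>w\<close> iff \<open>w i < w (i + 1)\<close>.  Hence \<open>x\<^sub>l\<close> is the sum of the
  permutations that increase on the first \<open>c = l + 1\<close> points, and \<open>x\<^sub>-\<^sub>1 = x\<^sub>0\<close> because nothing is
  required for \<open>c = 0\<close> and for \<open>c = 1\<close>.

  With \<open>a = j + 1\<close> and \<open>b = k + 1\<close>, the coefficient of \<open>w\<close> in \<open>x\<^sub>j x\<^sub>k\<close> is the number of
  arrangements \<open>r = v\<^sup>-\<^sup>1\<close> of \<open>1, \<dots>, n + 1\<close> in which \<open>1, \<dots>, b\<close> occur in this order and whose first \<open>a\<close>
  entries have increasing images under \<open>w\<close>.  If \<open>c\<close> of the first \<open>a\<close> entries are at most \<open>b\<close>, these are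
  \<open>1, \<dots>, c\<close>, so \<open>w\<close> must increase on them; the other \<open>a - c\<close> entries can be chosen freely
  above \<open>b\<close>, their order is forced by \<open>w\<close>, and the tail is a shuffle of \<open>c + 1, \<dots>, b\<close> with an
  arbitrary arrangement of what remains.
\<close>

subsection \<open>Counting arrangements\<close>

text \<open>Such a list is a shuffle of \<open>bs\<close> with an arrangement of \<open>E\<close>,
  and deleting \<open>bs\<close> recovers the arrangement. So the sets of shuffles for different
  arrangements are disjoint, and each is counted by the binomial coefficient.\<close>

lemma card_lists_with_filter:
  assumes "distinct bs" and "finite E" and "set bs \<inter> E = {}"
  shows "card {zs \<in> permutations_of_set (set bs \<union> E). filter (\<lambda>x. x \<in> set bs) zs = bs} =
    ((length bs + card E) choose length bs) * fact (card E)"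
proof -
  have "{zs \<in> permutations_of_set (set bs \<union> E). filter (\<lambda>x. x \<in> set bs) zs = bs} =
    (\<Union>es\<in>permutations_of_set E. shuffles bs es)" (is "?L = ?R")
  proof (intro equalityI subsetI)
    fix zs assume zs: "zs \<in> ?L"
    let ?es = "filter (\<lambda>x. x \<notin> set bs) zs"
    have "zs \<in> shuffles bs ?es"
      using partition_in_shuffles[of zs "\<lambda>x. x \<in> set bs"] zs by simp
    moreover have "?es \<in> permutations_of_set E"
      using zs assms(3) by (auto simp: permutations_of_set_def)
    ultimately show "zs \<in> ?R" by blast
  next
    fix zs assume "zs \<in> ?R"
    then obtain es where es: "set es = E" "distinct es" "zs \<in> shuffles bs es"
      by (auto simp: permutations_of_set_def)
    with assms show "zs \<in> ?L"
      using set_shuffles[of zs bs es] distinct_disjoint_shuffles[of bs es zs]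
        filter_shuffles_disjoint1(1)[of bs es zs]
      by (auto simp: permutations_of_set_def)
  qed
  moreover have "card (\<Union>es\<in>permutations_of_set E. shuffles bs es) =
      (\<Sum>es\<in>permutations_of_set E. card (shuffles bs es))"
  proof (rule card_UN_disjoint)
    show "\<forall>es\<in>permutations_of_set E. \<forall>es'\<in>permutations_of_set E.
        es \<noteq> es' \<longrightarrow> shuffles bs es \<inter> shuffles bs es' = {}"
    proof (intro ballI impI, rule ccontr)
      fix es es' assume *: "es \<in> permutations_of_set E" "es' \<in> permutations_of_set E" "es \<noteq> es'"
      assume "shuffles bs es \<inter> shuffles bs es' \<noteq> {}"
      then obtain zs where "zs \<in> shuffles bs es" "zs \<in> shuffles bs es'" by blast
      then have "es = es'"
        using filter_shuffles_disjoint1(2)[of bs es zs] filter_shuffles_disjoint1(2)[of bs es' zs]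
          * assms(3) by (simp add: permutations_of_set_def)
      then show False using *(3) by simp
    qed
  qed simp_all
  moreover have "card (shuffles bs es) = (length bs + card E) choose length bs"
    if "es \<in> permutations_of_set E" for es
    using that assms(3) card_disjoint_shuffles[of bs es]
    by (auto simp: permutations_of_set_def distinct_card)
  ultimately show ?thesis using assms(2) by simp
qed

text \<open>Cutting an interval list anywhere leaves two intervals. With the first \<open>a\<close>
  entries as \<open>ys\<close>, this shows that those of them that are at most \<open>b\<close> are
  exactly \<open>1, ..., c\<close>.\<close>

lemma filter_eq_upt_prefix:
  assumes "filter P ys @ us = [Suc 0..<Suc b]"
  shows "\<exists>c\<le>b. filter P ys = [Suc 0..<Suc c] \<and> us = [Suc c..<Suc b]"
proof -
  let ?c = "length (filter P ys)"
  have len: "?c \<le> b"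
    using arg_cong[OF assms, of length] by (simp del: upt_Suc)
  moreover have "filter P ys = take ?c [Suc 0..<Suc b]"
    using assms by (metis append_eq_conv_conj)
  moreover have "us = drop ?c [Suc 0..<Suc b]"
    using assms by (metis append_eq_conv_conj)
  moreover have "take ?c [Suc 0..<Suc b] = [Suc 0..<Suc ?c]"
    using len by (simp add: take_upt del: upt_Suc)
  moreover have "drop ?c [Suc 0..<Suc b] = [Suc ?c..<Suc b]"
    using len by (simp add: drop_upt del: upt_Suc)
  ultimately show ?thesis by metis
qed

section \<open>Listing a finite set by increasing values of an injective function\<close>

definition sort_by :: "('a \<Rightarrow> 'b::linorder) \<Rightarrow> 'a set \<Rightarrow> 'a list" where
  "sort_by p A = map (inv_into A p) (sorted_list_of_set (p ` A))"

lemma sort_by: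
  assumes "finite A" and "inj_on p A"
  shows "map p (sort_by p A) = sorted_list_of_set (p ` A)"
    and "set (sort_by p A) = A" and "distinct (sort_by p A)"
    and "length (sort_by p A) = card A"
proof -
  show "map p (sort_by p A) = sorted_list_of_set (p ` A)"
    using assms unfolding sort_by_def map_map
    by (intro map_idI) (auto simp: f_inv_into_f)
  show "set (sort_by p A) = A"
    using assms by (auto simp: sort_by_def)
  show "distinct (sort_by p A)"
    using assms by (auto simp: sort_by_def distinct_map intro: inj_on_inv_into)
  then show "length (sort_by p A) = card A"
    using \<open>set (sort_by p A) = A\<close> distinct_card by metis
qed

text \<open>The sorted list of values is determined by the set, and injectivity of \<open>p\<close>
  carries this over to the entries. This is why the order of the first \<open>a\<close> entries is
  forced.\<close>

lemma sort_by_unique: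
  assumes "finite A" "inj_on p A" "set ys = A" "sorted_wrt (<) (map p ys)"
  shows "ys = sort_by p A"
proof -
  have "map p ys = sorted_list_of_set (p ` A)"
    using assms by (metis list.set_map sorted_list_of_set.idem_if_sorted_distinct strict_sorted_iff)
  then have "map p ys = map p (sort_by p A)"
    using sort_by(1)[OF assms(1,2)] by simp
  then show ?thesis
    using assms sort_by(2)[OF assms(1,2)] by (metis Un_absorb inj_on_map_eq_map)
qed

text \<open>On elements where \<open>p\<close> is increasing, the order by \<open>p\<close>-values
  is the natural order.\<close>

lemma filter_sort_by:
  assumes "finite A" "inj_on p A" "strict_mono_on {x\<in>A. P x} p"
  shows "filter P (sort_by p A) = sorted_list_of_set {x \<in> A. P x}"
proof -
  note s = sort_by[OF assms(1,2)]
  have "sorted_wrt (<) (map p (sort_by p A))" by (simp add: s)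
  then have "sorted_wrt (\<lambda>x y. p x < p y) (filter P (sort_by p A))"
    by (simp add: sorted_wrt_map sorted_wrt_filter)
  moreover have "x < y" if "x \<in> set (filter P (sort_by p A))" "y \<in> set (filter P (sort_by p A))" "p x < p y"
    for x y
  proof (rule ccontr)
    assume "\<not> x < y"
    then have "y \<le> x" by simp
    then have "p y \<le> p x"
      using assms(3) that s(2) by (auto simp: strict_mono_on_def le_less)
    with that show False by simp
  qed
  ultimately have "sorted_wrt (<) (filter P (sort_by p A))"
    by (rule sorted_wrt_mono_rel[rotated])
  then show ?thesis
    using s(2) by (metis set_filter sorted_list_of_set.idem_if_sorted_distinct strict_sorted_iff)
qed

text \<open>Arrangements correspond to triples \<open>(c, E, zs)\<close>: the first \<open>a\<close>
  entries are \<open>1, ..., c\<close> and a set \<open>E\<close> of numbers above \<open>b\<close>,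
  in the order forced by \<open>p\<close>, and \<open>zs\<close> is the tail. Choosing
  \<open>E\<close> gives the second binomial coefficient, choosing \<open>zs\<close> the other two
  factors.\<close>

lemma card_arrangements:
  fixes p :: "nat \<Rightarrow> nat"
  assumes "p permutes {1..N}" and "a \<le> N" and "b \<le> N"
  shows "card {xs \<in> permutations_of_set {1..N}.
      filter (\<lambda>x. x \<le> b) xs = [1..<Suc b] \<and> sorted_wrt (<) (map p (take a xs))} =
    (\<Sum>c | c \<le> min a b \<and> strict_mono_on {1..c} p.
      ((N - a) choose (b - c)) * ((N - b) choose (a - c)) * fact (N - b - (a - c)))"
proof -
  let ?L = "{xs \<in> permutations_of_set {1..N}.
      filter (\<lambda>x. x \<le> b) xs = [1..<Suc b] \<and> sorted_wrt (<) (map p (take a xs))}"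
  let ?C = "{c. c \<le> min a b \<and> strict_mono_on {1..c} p}"
  let ?E = "\<lambda>c. {E. E \<subseteq> {Suc b..N} \<and> card E = a - c}"
  let ?Z = "\<lambda>c E. {zs \<in> permutations_of_set (set [Suc c..<Suc b] \<union> ({Suc b..N} - E)).
     filter (\<lambda>x. x \<in> set [Suc c..<Suc b]) zs = [Suc c..<Suc b]}"
  let ?A = "\<lambda>c E. {1..c} \<union> E"
  let ?f = "\<lambda>(c, E, zs). sort_by p (?A c E) @ zs"
  let ?D = "SIGMA c:?C. SIGMA E:?E c. ?Z c E"
  have inj: "inj_on p A" for A
    using permutes_inj[OF assms(1)] by (rule inj_on_subset) simp
  have A: "finite (?A c E)" "card (?A c E) = a" "length (sort_by p (?A c E)) = a"
      "set (sort_by p (?A c E)) = ?A c E" "distinct (sort_by p (?A c E))"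
      "sorted_wrt (<) (map p (sort_by p (?A c E)))"
    if "c \<in> ?C" "E \<in> ?E c" for c E
  proof -
    have fE: "finite E" using that finite_subset by blast
    moreover have "{1..c} \<inter> E = {}" using that by fastforce
    ultimately show fin: "finite (?A c E)" and card: "card (?A c E) = a"
      using that by (auto simp: card_Un_disjoint)
    note s = sort_by[OF fin inj]
    show "length (sort_by p (?A c E)) = a" using s(4) card by simp
    show "set (sort_by p (?A c E)) = ?A c E" "distinct (sort_by p (?A c E))" 
      using s by blast+
    show "sorted_wrt (<) (map p (sort_by p (?A c E)))" by (simp only: s(1)) simp
  qed
  \<comment> \<open>As \<open>c \<le> b\<close>, intersecting with the two ranges separates
    \<open>{1..c}\<close> from \<open>E\<close>, so the set of the first \<open>a\<close> entries
    determines \<open>c\<close> and \<open>E\<close>.\<close>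
  have A_Int: "?A c E \<inter> {1..b} = {1..c}" "?A c E \<inter> {Suc b..N} = E"
    if "c \<in> ?C" "E \<in> ?E c" for c E
    using that by (auto dest: subsetD)
  have "bij_betw ?f ?D ?L"
    unfolding bij_betw_def
  proof (intro conjI)
    show "inj_on ?f ?D"
    proof (rule inj_onI)
      fix x y assume "x \<in> ?D" and "y \<in> ?D" and f: "?f x = ?f y"
      obtain c E zs where x: "x = (c, E, zs)" by (rule prod_cases3)
      obtain c' E' zs' where y: "y = (c', E', zs')" by (rule prod_cases3)
      have mem: "c \<in> ?C" "E \<in> ?E c" "c' \<in> ?C" "E' \<in> ?E c'"
        using \<open>x \<in> ?D\<close> \<open>y \<in> ?D\<close> unfolding x y mem_Sigma_iff by simp_all
      have eq: "sort_by p (?A c E) @ zs = sort_by p (?A c' E') @ zs'" using f unfolding x y prod.case .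
      \<comment> \<open>Both initial blocks have length \<open>a\<close>, so the concatenations
        agree block by block.\<close>
      have 1: "sort_by p (?A c E) = sort_by p (?A c' E')" and 2: "zs = zs'"
        using eq A(3)[OF mem(1,2)] A(3)[OF mem(3,4)] by simp_all
      have "?A c E = set (sort_by p (?A c E))" by (rule A(4)[OF mem(1,2), symmetric])
      also have "\<dots> = ?A c' E'" unfolding 1 by (rule A(4)[OF mem(3,4)])
      finally have "?A c E = ?A c' E'" .
      then have "{1..c} = {1..c'}" "E = E'"
        using A_Int[OF mem(1,2)] A_Int[OF mem(3,4)] by argo+
      then show "x = y" using 2 x y by (metis card_atLeastAtMost diff_Suc_1)
    qed
    show "?f ` ?D = ?L"
    proof (intro equalityI subsetI)
      fix xs assume "xs \<in> ?f ` ?D"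
      then obtain x where x: "xs = ?f x" "x \<in> ?D" by (rule imageE)
      obtain c E zs where "x = (c, E, zs)" by (rule prod_cases3)
      with x have c: "c \<in> ?C" and E: "E \<in> ?E c" and zs: "zs \<in> ?Z c E"
        and xs: "xs = sort_by p (?A c E) @ zs" by (simp_all only: mem_Sigma_iff prod.case)
      \<comment> \<open>The other entries of \<open>zs\<close> lie above \<open>b\<close>, so the
        two filters agree on \<open>zs\<close>.\<close>
      have "filter (\<lambda>x. x \<le> b) zs = filter (\<lambda>x. x \<in> set [Suc c..<Suc b]) zs"
        using zs by (intro filter_cong) (auto simp: permutations_of_set_def)
      then have "filter (\<lambda>x. x \<le> b) zs = [Suc c..<Suc b]" using zs by simp
      moreover have "{x \<in> ?A c E. x \<le> b} = {1..c}" using c E by fastforce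
      then have "filter (\<lambda>x. x \<le> b) (sort_by p (?A c E)) = sorted_list_of_set {1..c}"
        using filter_sort_by[of "?A c E" p "\<lambda>x. x \<le> b", OF A(1)[OF c E] inj] c
        by simp
      then have "filter (\<lambda>x. x \<le> b) (sort_by p (?A c E)) = [1..<Suc c]"
        by (metis atLeastLessThanSuc_atLeastAtMost sorted_list_of_set_range)
      moreover have "[1..<Suc b] = [1..<Suc c] @ [Suc c..<Suc b]"
        using c upt_add_eq_append[of 1 "Suc c" "b - c"] by (simp del: upt_Suc)
      moreover have "set xs = {1..N}" "distinct xs"
      proof -
        have "set zs = set [Suc c..<Suc b] \<union> ({Suc b..N} - E)" "distinct zs"
          using zs by (simp_all add: permutations_of_set_def)
        moreover have "?A c E \<inter> (set [Suc c..<Suc b] \<union> ({Suc b..N} - E)) = {}"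
          using c E by auto
        moreover have "?A c E \<union> (set [Suc c..<Suc b] \<union> ({Suc b..N} - E)) = {1..N}"
          using c E assms by auto
        ultimately show "set xs = {1..N}" "distinct xs"
          using A(4,5)[OF c E] xs by (simp_all del: upt_Suc)
      qed
      moreover have "take a xs = sort_by p (?A c E)" using A(3)[OF c E] xs by simp
      ultimately show "xs \<in> ?L" using A(6)[OF c E] xs by (simp add: permutations_of_set_def)
    next
      fix xs assume xs: "xs \<in> ?L"
      let ?ys = "take a xs" and ?zs = "drop a xs"
      have d: "distinct xs" "set xs = {1..N}" using xs by (auto simp: permutations_of_set_def)
      have lxs: "length xs = N" using distinct_card[OF d(1)] d(2) by simp
      have fx: "filter (\<lambda>x. x \<le> b) ?ys @ filter (\<lambda>x. x \<le> b) ?zs = [Suc 0..<Suc b]"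
        using xs by (simp flip: filter_append)
      obtain c where c: "c \<le> b" "filter (\<lambda>x. x \<le> b) ?ys = [Suc 0..<Suc c]"
        "filter (\<lambda>x. x \<le> b) ?zs = [Suc c..<Suc b]"
        using filter_eq_upt_prefix[OF fx] by blast
      define E where "E = set ?ys \<inter> {Suc b..N}"
      have sx: "set ?ys \<union> set ?zs = {1..N}" by (metis append_take_drop_id d(2) set_append)
      have dx: "set ?ys \<inter> set ?zs = {}" by (metis append_take_drop_id d(1) distinct_append)
      have fy: "{x \<in> set ?ys. x \<le> b} = {1..c}"
        unfolding set_filter[symmetric] c(2) by auto
      have "x \<in> {Suc b..N}" if "x \<in> set ?ys" "\<not> x \<le> b" for x
        using that sx by auto
      then have "set ?ys = {x \<in> set ?ys. x \<le> b} \<union> E" unfolding E_def by blast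
      then have sy: "set ?ys = ?A c E" unfolding fy .
      have fz: "{x \<in> set ?zs. x \<le> b} = {Suc c..b}"
        unfolding set_filter[symmetric] c(3) by auto
      have sz: "set ?zs = set [Suc c..<Suc b] \<union> ({Suc b..N} - E)"
      proof (rule Set.set_eqI)
        fix x
        show "x \<in> set ?zs \<longleftrightarrow> x \<in> set [Suc c..<Suc b] \<union> ({Suc b..N} - E)"
        proof (cases "x \<le> b")
          case True
          then have "x \<in> set ?zs \<longleftrightarrow> x \<in> {x \<in> set ?zs. x \<le> b}" by simp
          then show ?thesis unfolding fz using True by auto
        next
          case False
          then have "x \<in> set ?zs \<longleftrightarrow> x \<in> {1..N} \<and> x \<notin> set ?ys" using sx dx by blast
          then show ?thesis using False by (auto simp: E_def)
        qed
      qed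
      have "card (set ?ys) = a" using d(1) lxs assms(2) by (simp add: distinct_card)
      moreover have "{1..c} \<inter> E = {}" using c(1) by (auto simp: E_def)
      moreover have "finite E" by (simp add: E_def)
      ultimately have ca: "c + card E = a" using sy by (simp add: card_Un_disjoint)
      \<comment> \<open>The numbers \<open>1, ..., c\<close> appear in this order among the first
        \<open>a\<close> entries, whose \<open>p\<close>-values increase; hence \<open>c\<close>
        lies in \<open>?C\<close>.\<close>
      have sp: "sorted_wrt (<) (map p ?ys)" using xs by simp
      then have "sorted_wrt (\<lambda>x y. p x < p y) [Suc 0..<Suc c]"
        unfolding c(2)[symmetric] by (simp add: sorted_wrt_map sorted_wrt_filter)
      then have "strict_mono_on {1..c} p"
        unfolding strict_mono_on_def sorted_wrt_iff_nth_less
      proof (intro allI impI ballI)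
        fix r r' assume *: "\<forall>i j. i < j \<longrightarrow> j < length [Suc 0..<Suc c] \<longrightarrow>
            p ([Suc 0..<Suc c] ! i) < p ([Suc 0..<Suc c] ! j)"
          "r \<in> {1..c} \<and> r' \<in> {1..c} \<and> r < r'"
        \<comment> \<open>The number \<open>r\<close> stands at index \<open>r - 1\<close> of the
          list.\<close>
        then show "p r < p r'" using *(1)[rule_format, of "r-1" "r'-1"] 
          by (auto simp del: upt_Suc)
      qed
      then have cC: "c \<in> ?C" using c(1) ca by simp
      moreover have eE: "E \<in> ?E c" using ca by (auto simp: E_def)
      moreover have "?zs \<in> ?Z c E"
      proof -
        have iff: "x \<in> set [Suc c..<Suc b] \<longleftrightarrow> x \<le> b" if "x \<in> set ?zs" for x
          using that unfolding set_upt atLeastLessThanSuc_atLeastAtMost fz[symmetric] by simp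
        have "filter (\<lambda>x. x \<in> set [Suc c..<Suc b]) ?zs = filter (\<lambda>x. x \<le> b) ?zs"
          by (rule filter_cong[OF HOL.refl iff])
        moreover have "distinct ?zs" using d(1) by simp
        ultimately show ?thesis
          unfolding permutations_of_set_def mem_Collect_eq using sz c(3) by (simp only:)
      qed
      moreover have "?ys = sort_by p (?A c E)"
        using sort_by_unique[OF A(1)[OF cC eE] inj sy sp] .
      then have "xs = sort_by p (?A c E) @ ?zs" by (metis append_take_drop_id)
      then have "xs = ?f (c, E, ?zs)" unfolding prod.case .
      ultimately show "xs \<in> ?f ` ?D" by (intro image_eqI[of _ _ "(c, E, ?zs)"] SigmaI)
    qed
  qed
  then have "card ?L = card ?D" by (rule bij_betw_same_card[symmetric])
  also have "\<dots> = (\<Sum>c\<in>?C. \<Sum>E\<in>?E c. card (?Z c E))"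
  proof -
    have fE: "finite (?E c)" for c
      by (rule finite_subset[of _ "Pow {Suc b..N}"]) auto
    have fZ: "finite (?Z c E)" for c E
      by (rule finite_subset[OF _ finite_permutations_of_set]) blast
    have "card (SIGMA E:?E c. ?Z c E) = (\<Sum>E\<in>?E c. card (?Z c E))" for c
      by (rule card_SigmaI[OF fE]) (use fZ in blast)
    moreover have "finite (SIGMA E:?E c. ?Z c E)" for c
      by (rule finite_SigmaI[OF fE fZ])
    ultimately show ?thesis
      by (subst card_SigmaI) (simp_all only: finite_Collect_le_nat finite_Collect_conjI min.bounded_iff simp_thms ball_triv)
  qed
  also have "\<dots> = (\<Sum>c\<in>?C. ((N - a) choose (b - c)) * ((N - b) choose (a - c)) * fact (N - b - (a - c)))"
  proof (rule sum.cong[OF HOL.refl])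
    fix c assume c: "c \<in> ?C"
    have "card (?Z c E) = ((N - a) choose (b - c)) * fact (N - b - (a - c))" if E: "E \<in> ?E c" for E
    proof -
      \<comment> \<open>The existence of \<open>E\<close> makes the truncated subtractions below
        genuine. If there is no such \<open>E\<close>, the sum over \<open>?E c\<close> is empty,
        and \<open>(N - b) choose (a - c)\<close> vanishes as well.\<close>
      have le: "a - c \<le> N - b" using E card_mono[of "{Suc b..N}" E] by simp
      have cE: "card ({Suc b..N} - E) = N - b - (a - c)"
        using E by (subst card_Diff_subset) (auto intro: finite_subset)
      have "card (?Z c E) = ((b - c + card ({Suc b..N} - E)) choose (b - c))
         * fact (card ({Suc b..N} - E))"
        by (subst card_lists_with_filter) (auto simp del: upt_Suc)
      moreover have "b - c + (N - b - (a - c)) = N - a"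
        using c le assms by auto
      ultimately show ?thesis using cE by simp
    qed
    moreover have "card (?E c) = (N - b) choose (a - c)"
      using n_subsets[of "{Suc b..N}" "a - c"] by simp
    ultimately show "(\<Sum>E\<in>?E c. card (?Z c E)) =
        ((N - a) choose (b - c)) * ((N - b) choose (a - c)) * fact (N - b - (a - c))"
      by simp
  qed
  finally show ?thesis .
qed

section \<open>Arrangements as inverses of permutations\<close>

lemma permutes_eqI:
  assumes "p permutes A" "q permutes A" "\<And>x. x \<in> A \<Longrightarrow> p x = q x"
  shows "p = q"
  using assms by (metis ext permutes_not_in)

lemma sorted_map_upt_iff:
  fixes f :: "nat \<Rightarrow> nat"
  shows "sorted_wrt (<) (map f [1..<Suc m]) \<longleftrightarrow> strict_mono_on {1..m} f"
proof
  assume *: "sorted_wrt (<) (map f [1..<Suc m])"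
  show "strict_mono_on {1..m} f"
  proof (rule strict_mono_onI)
    fix r t assume "r \<in> {1..m}" "t \<in> {1..m}" "r < t"
    then show "f r < f t"
      using sorted_wrt_nth_less[OF *, of "r - 1" "t - 1"] by (simp del: upt_Suc)
  qed
next
  assume "strict_mono_on {1..m} f"
  then show "sorted_wrt (<) (map f [1..<Suc m])"
    by (auto simp: sorted_wrt_iff_nth_less strict_mono_on_def simp del: upt_Suc)
qed

text \<open>The list has \<open>x\<close> at position \<open>q x\<close>, so \<open>q\<close>
  increases along it. Thus \<open>1, ..., b\<close> occur in their natural order iff their positions
  increase.\<close>

lemma filter_map_upt_iff:
  assumes "q permutes {1..N}" and "b \<le> N"
  shows "filter (\<lambda>x. x \<le> b) (map (inv' q) [1..<Suc N]) = [1..<Suc b] \<longleftrightarrow> strict_mono_on {1..b} q"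
proof -
  let ?xs = "map (inv' q) [1..<Suc N]"
  let ?fs = "filter (\<lambda>x. x \<le> b) ?xs"
  have "set ?xs = {1..N}"
    using permutes_image[OF permutes_inv[OF assms(1)]]
    by (simp add: atLeastLessThanSuc_atLeastAtMost del: upt_Suc)
  then have sf: "set ?fs = {1..b}" using assms(2) by auto
  have sx: "sorted_wrt (\<lambda>x y. q x < q y) ?fs"
    by (intro sorted_wrt_filter)
      (simp add: sorted_wrt_map permutes_inverses[OF assms(1)] del: upt_Suc)
  show ?thesis
  proof
    assume "?fs = [1..<Suc b]"
    then have "sorted_wrt (<) (map q [1..<Suc b])"
      using sx by (simp add: sorted_wrt_map del: upt_Suc)
    then show "strict_mono_on {1..b} q" by (simp only: sorted_map_upt_iff)
  next
    assume mono: "strict_mono_on {1..b} q"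
    have "x < y" if "x \<in> set ?fs" "y \<in> set ?fs" "q x < q y" for x y
      using that mono unfolding sf
      by (metis linorder_less_linear order_less_asym strict_mono_onD)
    then have "sorted_wrt (<) ?fs"
      using sx by (rule sorted_wrt_mono_rel)
    then have "sorted ?fs" "distinct ?fs" unfolding strict_sorted_iff by blast+
    moreover have "sorted [1..<Suc b]" "distinct [1..<Suc b]" "set [1..<Suc b] = set ?fs"
      unfolding sf by (simp_all add: atLeastLessThanSuc_atLeastAtMost del: upt_Suc)
    ultimately show "?fs = [1..<Suc b]"
      by (intro sorted_distinct_set_unique) auto
  qed
qed

text \<open>A permutation is determined by its inverse on \<open>{1..N}\<close>; surjectivity
  follows because both sets have \<open>N!\<close> elements.\<close>

lemma bij_betw_permutes_lists:
  "bij_betw (\<lambda>q. map (inv' q) [1..<Suc N]) {q. q permutes {1..N}} (permutations_of_set {1..N})"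
proof -
  let ?P = "{q. q permutes {1..N}}"
  let ?h = "\<lambda>q. map (inv' q) [1..<Suc N]"
  have "inj_on ?h ?P"
  proof (rule inj_onI)
    fix p q assume "p \<in> ?P" "q \<in> ?P" and eq: "?h p = ?h q"
    then have pq: "p permutes {1..N}" "q permutes {1..N}" by auto
    have "inv' p = inv' q"
    proof (rule permutes_eqI[OF pq[THEN permutes_inv]])
      fix x assume "x \<in> {1..N}"
      then show "inv' p x = inv' q x"
        using eq by (auto simp: map_eq_conv simp del: upt_Suc)
    qed
    then show "p = q" using pq by (metis permutes_inv_inv)
  qed
  moreover have "?h ` ?P \<subseteq> permutations_of_set {1..N}"
  proof
    fix xs assume "xs \<in> ?h ` ?P"
    then obtain q where q: "q permutes {1..N}" "xs = ?h q" by blast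
    then show "xs \<in> permutations_of_set {1..N}"
      using permutes_image[OF permutes_inv[OF q(1)]] permutes_inj_on[OF permutes_inv[OF q(1)]]
      by (auto simp: permutations_of_set_def distinct_map atLeastLessThanSuc_atLeastAtMost
        simp del: upt_Suc)
  qed
  moreover have "card ?P = card (permutations_of_set {1..N})"
    by (simp add: card_permutations)
  ultimately show ?thesis
    unfolding bij_betw_def by (metis card_image card_subset_eq finite_permutations_of_set)
qed

text \<open>This counts factorizations of \<open>p\<close>: \<open>q\<close> is the right factor,
  and \<open>p \<circ> inv' q\<close> is then the left one. The arrangement of the previous count is
  the list of values of \<open>inv' q\<close>.\<close>

lemma card_permutations_incr:
  fixes p :: "nat \<Rightarrow> nat"
  assumes "p permutes {1..N}" and "a \<le> N" and "b \<le> N"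
  shows "card {q. q permutes {1..N} \<and> strict_mono_on {1..b} q \<and> strict_mono_on {1..a} (p \<circ> inv' q)} =
    (\<Sum>c | c \<le> min a b \<and> strict_mono_on {1..c} p.
      ((N - a) choose (b - c)) * ((N - b) choose (a - c)) * fact (N - b - (a - c)))"
proof -
  let ?h = "\<lambda>q. map (inv' q) [1..<Suc N]"
  let ?Q = "\<lambda>xs. filter (\<lambda>x. x \<le> b) xs = [1..<Suc b] \<and> sorted_wrt (<) (map p (take a xs))"
  have "?Q (?h q) \<longleftrightarrow> strict_mono_on {1..b} q \<and> strict_mono_on {1..a} (p \<circ> inv' q)"
    if "q permutes {1..N}" for q
  proof -
    have "map p (take a (?h q)) = map (p \<circ> inv' q) [1..<Suc a]"
      using assms(2) by (simp add: take_map take_upt del: upt_Suc)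
    then show ?thesis
      using filter_map_upt_iff[OF that assms(3)] sorted_map_upt_iff[of "p \<circ> inv' q" a] by simp
  qed
  then have "bij_betw ?h {q \<in> {q. q permutes {1..N}}. strict_mono_on {1..b} q \<and> strict_mono_on {1..a} (p \<circ> inv' q)}
    {xs \<in> permutations_of_set {1..N}. ?Q xs}"
    by (intro bij_betw_Collect[OF bij_betw_permutes_lists]) blast
  from bij_betw_same_card[OF this] show ?thesis
    unfolding card_arrangements[OF assms] mem_Collect_eq .
qed

subsection \<open>The isomorphism with the symmetric group\<close>

lemma word_prod_Nil [simp]: "word_prod W [] = \<one>\<^bsub>W\<^esub>"
  and word_prod_Cons [simp]: "word_prod W (x # xs) = x \<otimes>\<^bsub>W\<^esub> word_prod W xs"
  by (simp_all add: word_prod_def)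

lemma (in group) word_prod_closed:
  "set us \<subseteq> carrier G \<Longrightarrow> word_prod G us \<in> carrier G"
  by (induction us) auto

lemma (in group) word_prod_append:
  "set us \<subseteq> carrier G \<Longrightarrow> set vs \<subseteq> carrier G \<Longrightarrow>
    word_prod G (us @ vs) = word_prod G us \<otimes> word_prod G vs"
  by (induction us) (auto simp: m_assoc word_prod_closed)

section \<open>Words in adjacent transpositions\<close>

lemma apply_adj_transps_append:
  "apply_adj_transps (us @ vs) = apply_adj_transps us \<circ> apply_adj_transps vs"
  by (induction us) (simp_all add: comp_assoc del: One_nat_def)

lemma apply_adj_transps_rev:
  "apply_adj_transps (rev us) \<circ> apply_adj_transps us = id"
proof (induction us)
  case (Cons i us)
  then show ?case by (simp add: fun_eq_iff)
qed simp

text \<open>Transpositions generate the permutations, and \<open>adj_transp_seq\<close> writes each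
  of them as a word in adjacent ones; it is applied to the smaller point first, whence
  \<open>min\<close> and \<open>max\<close>.\<close>

lemma apply_adj_transps_words_surj:
  assumes "p permutes {1..Suc n}"
  shows "\<exists>us. set us \<subseteq> {1..n} \<and> apply_adj_transps us = p"
  using assms finite_atLeastAtMost
proof (induction rule: permutes_induct)
  case id
  show ?case by (rule exI[of _ "[]"]) simp
next
  case (swap a b p)
  then obtain us where us: "set us \<subseteq> {1..n}" "apply_adj_transps us = p" by blast
  define c d where "c = min a b" and "d = max a b"
  have cd: "c < d" "c \<ge> 1" "d \<le> Suc n" "transpose c d = transpose a b"
    using swap by (auto simp: c_def d_def min_def max_def transpose_commute)
  have "apply_adj_transps (adj_transp_seq c d @ us) = transpose a b \<circ> p"
    using us cd by (simp add: apply_adj_transps_append adj_transp_seq_correct)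
  moreover have "set (adj_transp_seq c d @ us) \<subseteq> {1..n}"
    using us cd by (auto simp: set_adj_transp_seq)
  ultimately show ?case by blast
qed

(* The letter of the word that carries the larger value past the smaller one can be deleted. *)
lemma adj_transps_exchange:
  assumes "apply_adj_transps us i > apply_adj_transps us (Suc i)"
  shows "\<exists>vs. length vs < length us \<and> set vs \<subseteq> set us \<and>
    apply_adj_transps vs = apply_adj_transps us \<circ> transpose i (Suc i)"
  using assms
proof (induction us)
  case (Cons t us)
  let ?p = "apply_adj_transps us"
  show ?case
  proof (cases "?p i > ?p (Suc i)")
    case True
    then obtain vs where "length vs < length us" "set vs \<subseteq> set us"
      "apply_adj_transps vs = ?p \<circ> transpose i (Suc i)"
      using Cons.IH by blast
    then show ?thesis
      by (intro exI[of _ "t # vs"]) (auto simp: comp_assoc)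
  next
    case False
    have inj: "inj ?p" by (simp add: bij_is_inj permutation_apply_adj_transps permutation_bijective)
    then have lt: "?p i < ?p (Suc i)" using False by (metis n_not_Suc_n inj_eq linorder_neqE_nat)
    \<comment> \<open>The transposition of \<open>t\<close> and \<open>Suc t\<close> reverses the
      order of no other pair, so these are the two values. Multiplying by it on the left is then the
      same as swapping \<open>i\<close> and \<open>Suc i\<close> on the right, and the letter
      \<open>t\<close> can go.\<close>
    have "transpose t (Suc t) (?p i) > transpose t (Suc t) (?p (Suc i))"
      using Cons.prems by simp
    then have p: "?p i = t" "?p (Suc i) = Suc t"
      using lt by (auto simp: transpose_def split: if_splits)
    have "transpose t (Suc t) (?p x) = ?p (transpose i (Suc i) x)" for x
    proof (cases "x \<in> {i, Suc i}")
      case True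
      then show ?thesis using p by auto
    next
      case False
      then have "?p x \<noteq> t" "?p x \<noteq> Suc t" 
        using p inj_eq[OF inj, of x i] inj_eq[OF inj, of x "Suc i"] by simp_all
      then show ?thesis using False by (simp add: transpose_apply_other)
    qed
    then have "transpose t (Suc t) \<circ> ?p = ?p \<circ> transpose i (Suc i)" by (simp add: fun_eq_iff)
    then have e: "?p = apply_adj_transps (t # us) \<circ> transpose i (Suc i)"
      by (simp add: fun_eq_iff)
    show ?thesis by (intro exI[of _ us] conjI, simp, fastforce, rule e)
  qed
qed simp

lemma strict_mono_on_iff_Suc:
  fixes f :: "nat \<Rightarrow> nat"
  shows "strict_mono_on {1..Suc j} f \<longleftrightarrow> (\<forall>i\<in>{1..j}. f i < f (Suc i))"
proof
  assume *: "\<forall>i\<in>{1..j}. f i < f (Suc i)"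
  show "strict_mono_on {1..Suc j} f"
  proof (rule strict_mono_onI)
    fix x y assume "x \<in> {1..Suc j}" "y \<in> {1..Suc j}" "x < y"
    then show "f x < f y"
    proof (induction y)
      case (Suc y)
      then have "f y < f (Suc y)" using * by auto
      then show ?case using Suc by (cases "x = y") auto
    qed simp
  qed
qed (auto simp: strict_mono_on_def)

section \<open>Words in the Coxeter generators\<close>

context coxeter_system_type_A
begin

lemma s_in_S: "i \<in> {1..n} \<Longrightarrow> s i \<in> S"
  using labelling by (auto simp: bij_betw_def)

lemma s_closed: "i \<in> {1..n} \<Longrightarrow> s i \<in> carrier W"
  using s_in_S gens_in_carrier by blast

lemma map_s_in_S: "set us \<subseteq> {1..n} \<Longrightarrow> set (map s us) \<subseteq> S"
  unfolding set_map using s_in_S by blast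

lemma map_s_closed: "set us \<subseteq> {1..n} \<Longrightarrow> set (map s us) \<subseteq> carrier W"
  using map_s_in_S gens_in_carrier by blast

lemma s_square: "i \<in> {1..n} \<Longrightarrow> s i \<otimes> s i = \<one>"
  using pow_ord_eq_1[OF s_closed] gens_involutions[OF s_in_S] s_closed
  by (metis nat_pow_0 nat_pow_Suc numeral_2_eq_2 l_one)

lemma inv_s: "i \<in> {1..n} \<Longrightarrow> inv (s i) = s i"
  using s_square s_closed inv_equality by blast

text \<open>Words are lists of indices, so that the same list can be read in \<open>W\<close> and as
  a word of adjacent transpositions.\<close>

definition pr :: "nat list \<Rightarrow> 'a" where
  "pr us = word_prod W (map s us)"

lemma pr_Nil [simp]: "pr [] = \<one>"
  and pr_Cons [simp]: "pr (i # us) = s i \<otimes> pr us"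
  by (simp_all add: pr_def)

lemma pr_closed: "set us \<subseteq> {1..n} \<Longrightarrow> pr us \<in> carrier W"
  unfolding pr_def by (intro word_prod_closed map_s_closed)

lemma pr_append:
  "set us \<subseteq> {1..n} \<Longrightarrow> set vs \<subseteq> {1..n} \<Longrightarrow> pr (us @ vs) = pr us \<otimes> pr vs"
  unfolding pr_def map_append by (intro word_prod_append map_s_closed)

lemma pr_rev: "set us \<subseteq> {1..n} \<Longrightarrow> pr (rev us) = inv (pr us)"
  by (induction us) (auto simp: pr_append pr_closed s_closed inv_mult_group inv_s)

lemma words_cover_carrier:
  assumes "w \<in> carrier W"
  shows "\<exists>us. set us \<subseteq> {1..n} \<and> pr us = w"
proof -
  have "w \<in> generate W S" using assms generated by simp
  then show ?thesis
  proof (induction rule: generate.induct)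
    case one
    show ?case by (rule exI[of _ "[]"]) simp
  next
    case (incl h)
    then obtain i where "i \<in> {1..n}" "h = s i" using labelling by (auto simp: bij_betw_def)
    then show ?case by (intro exI[of _ "[i]"]) (auto simp: s_closed)
  next
    case (inv h)
    then obtain i where "i \<in> {1..n}" "h = s i" using labelling by (auto simp: bij_betw_def)
    then show ?case by (intro exI[of _ "[i]"]) (auto simp: s_closed inv_s)
  next
    case (eng g h)
    then obtain us vs where "set us \<subseteq> {1..n}" "pr us = g" "set vs \<subseteq> {1..n}" "pr vs = h" by blast
    then show ?case by (intro exI[of _ "us @ vs"]) (auto simp: pr_append)
  qed
qed

section \<open>Equal products in \<open>W\<close> give equal permutations\<close>

lemma ord_adjacent:
  assumes "i \<in> {1..n}" "j \<in> {1..n}" "j = i + 1 \<or> i = j + 1"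
  shows "ord (s i \<otimes> s j) = 3"
proof -
  have "ord (s j \<otimes> s i) = ord (s i \<otimes> s j)"
    using ord_inv[of "s i \<otimes> s j"] s_closed[OF assms(1)] s_closed[OF assms(2)]
      inv_s[OF assms(1)] inv_s[OF assms(2)] by (simp add: inv_mult_group)
  then show ?thesis using assms adjacent[of i] adjacent[of j] by auto
qed

text \<open>Commuting involutions have a product of order dividing 2; order 1 would give
  \<open>s i = s j\<close>, against the injectivity of the labelling.\<close>

lemma ord_nonadjacent:
  assumes "i \<in> {1..n}" "j \<in> {1..n}" "i \<noteq> j" "j \<noteq> i + 1" "i \<noteq> j + 1"
  shows "ord (s i \<otimes> s j) = 2"
proof -
  let ?x = "s i \<otimes> s j"
  note c = s_closed[OF assms(1)] s_closed[OF assms(2)]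
  have "?x \<otimes> ?x = s i \<otimes> (s j \<otimes> s i) \<otimes> s j" using c by (simp add: m_assoc)
  also have "s j \<otimes> s i = s i \<otimes> s j" using nonadjacent[OF assms] by simp
  also have "s i \<otimes> (s i \<otimes> s j) \<otimes> s j = (s i \<otimes> s i) \<otimes> (s j \<otimes> s j)" using c by (simp add: m_assoc)
  also have "\<dots> = \<one>" using assms by (simp add: s_square)
  finally have "?x [^] (2::nat) = \<one>" using c by (simp add: numeral_2_eq_2)
  then have "ord ?x dvd 2" using pow_eq_id c by simp
  moreover have "ord ?x \<noteq> 1"
  proof
    assume "ord ?x = 1"
    then have "?x = \<one>" using ord_eq_1 c by simp
    then have "inv (s j) = s i" using c by (intro inv_equality)
    then have "s i = s j" unfolding inv_s[OF assms(2)] by (rule HOL.sym)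
    then show False
      using inj_onD[OF bij_betw_imp_inj_on[OF labelling], of i j] assms(1-3) by blast
  qed
  ultimately show ?thesis using prime_nat_iff two_is_prime_nat by blast
qed

text \<open>For equal, neighbouring and distant indices the exponent is 1, 3 and 2, and these are
  also the orders of the corresponding products of transpositions. So every defining relation of
  \<open>W\<close> holds for permutations.\<close>

lemma adj_transps_relation:
  assumes "i \<in> {1..n}" "j \<in> {1..n}"
  shows "apply_adj_transps (concat (replicate (ord (s i \<otimes> s j)) [i, j])) = id"
proof -
  consider "i = j" | "j = i + 1 \<or> i = j + 1" | "i \<noteq> j" "j \<noteq> i + 1" "i \<noteq> j + 1" by blast
  then show ?thesis
  proof cases
    case 1
    then show ?thesis using assms by (simp add: s_square)
  next
    case 2
    then have "ord (s i \<otimes> s j) = 3" using ord_adjacent assms by blast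
    then show ?thesis using 2
      by (elim disjE; simp add: numeral_3_eq_3 fun_eq_iff transpose_def)
  next
    case 3
    then have "ord (s i \<otimes> s j) = 2" using ord_nonadjacent assms by blast
    then show ?thesis using 3
      by (simp add: numeral_2_eq_2 fun_eq_iff transpose_def)
  qed
qed

text \<open>Only the rule \<open>relation\<close> changes a word, and the relator it removes acts as
  the identity. Here \<open>inv_into\<close> reads off the index of a generator.\<close>

lemma coxeter_word_eq_imp_adj_transps_eq:
  assumes "coxeter_word_eq S (\<lambda>x y. ord (x \<otimes> y)) u v"
  shows "apply_adj_transps (map (inv_into {1..n} s) u) =
    apply_adj_transps (map (inv_into {1..n} s) v)"
  using assms
proof (induction rule: coxeter_word_eq.induct)
  case (relation u v x y)
  let ?t = "inv_into {1..n} s"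
  have "s ` {1..n} = S" using labelling by (rule bij_betw_imp_surj_on)
  with relation have xy: "x \<in> s ` {1..n}" "y \<in> s ` {1..n}" by (simp_all only:)
  have "apply_adj_transps (concat (replicate (ord (s (?t x) \<otimes> s (?t y))) [?t x, ?t y])) = id"
    by (rule adj_transps_relation[OF inv_into_into[OF xy(1)] inv_into_into[OF xy(2)]])
  then have "apply_adj_transps (concat (replicate (ord (x \<otimes> y)) [?t x, ?t y])) = id"
    unfolding f_inv_into_f[OF xy(1)] f_inv_into_f[OF xy(2)] .
  then show ?case
    by (simp only: apply_adj_transps_append map_append map_concat map_replicate list.map comp_id id_comp)
next
  case (trans u v w)
  then show ?case by (simp only:)
qed (simp_all only:)

text \<open>The presentation of \<open>W\<close> enters here: it makes the map to permutations well
  defined.\<close>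

lemma pr_eq_imp_adj_transps_eq:
  assumes "set us \<subseteq> {1..n}" "set vs \<subseteq> {1..n}" "pr us = pr vs"
  shows "apply_adj_transps us = apply_adj_transps vs"
proof -
  have inv: "map (inv_into {1..n} s) (map s us) = us" if "set us \<subseteq> {1..n}" for us
    unfolding map_map using that bij_betw_imp_inj_on[OF labelling]
    by (intro map_idI) (simp add: subset_iff)
  have "coxeter_word_eq S (\<lambda>x y. ord (x \<otimes> y)) (map s us) (map s vs)"
    using presented[OF map_s_in_S map_s_in_S] assms unfolding pr_def by blast
  then show ?thesis
    using coxeter_word_eq_imp_adj_transps_eq inv assms by metis
qed

section \<open>Braid relation, normal form and injectivity\<close>

lemma s_braid:
  assumes "1 \<le> i" "i < n"
  shows "s (Suc i) \<otimes> s i \<otimes> s (Suc i) = s i \<otimes> s (Suc i) \<otimes> s i"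
proof -
  let ?a = "s i" and ?b = "s (Suc i)"
  have c: "?a \<in> carrier W" "?b \<in> carrier W" using assms by (auto intro: s_closed)
  have i: "inv ?a = ?a" "inv ?b = ?b" using assms by (auto intro: inv_s)
  have "(?a \<otimes> ?b) [^] (3::nat) = \<one>"
    using pow_ord_eq_1[OF m_closed[OF c]] adjacent[OF assms] by simp
  \<comment> \<open>The cube splits into two palindromes of involutions, each its own
    inverse.\<close>
  then have "(?a \<otimes> ?b \<otimes> ?a) \<otimes> (?b \<otimes> ?a \<otimes> ?b) = \<one>"
    using c by (simp add: numeral_3_eq_3 m_assoc)
  then have "inv (?b \<otimes> ?a \<otimes> ?b) = ?a \<otimes> ?b \<otimes> ?a"
    using c by (intro inv_equality) auto
  then show ?thesis using c i by (simp add: inv_mult_group m_assoc)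
qed

text \<open>Words for representatives of the right cosets of the subgroup generated by
  \<open>s 1, ..., s (k - 1)\<close> in the one generated by \<open>s 1, ..., s k\<close>;
  \<open>i = k\<close> gives the empty word.\<close>

abbreviation down :: "nat \<Rightarrow> nat \<Rightarrow> nat list" where
  "down k i \<equiv> rev [Suc i..<Suc k]"

lemma pr_snoc:
  "set us \<subseteq> {1..n} \<Longrightarrow> j \<in> {1..n} \<Longrightarrow> pr (us @ [j]) = pr us \<otimes> s j"
  by (simp add: pr_append s_closed)

lemma pr_commute:
  assumes "set us \<subseteq> {1..n}" "j \<in> {1..n}" "\<And>x. x \<in> set us \<Longrightarrow> Suc x < j \<or> Suc j < x"
  shows "pr us \<otimes> s j = s j \<otimes> pr us"
  using assms(1,3)
proof (induction us)
  case Nil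
  then show ?case using s_closed[OF assms(2)] by simp
next
  case (Cons x us)
  then have c: "s x \<in> carrier W" "pr us \<in> carrier W" "s j \<in> carrier W"
    using assms(2) by (auto intro!: s_closed pr_closed)
  have "pr (x # us) \<otimes> s j = s x \<otimes> (s j \<otimes> pr us)" using Cons c by (simp add: m_assoc)
  also have "\<dots> = (s x \<otimes> s j) \<otimes> pr us" using c by (simp add: m_assoc)
  also have "s x \<otimes> s j = s j \<otimes> s x"
    using Cons.prems(1) Cons.prems(2)[of x] assms(2) by (intro nonadjacent) auto
  finally show ?case using c by (simp add: m_assoc)
qed

text \<open>The letter \<open>j\<close> commutes leftwards past all letters below
  \<open>j - 1\<close> and meets \<open>j, j - 1\<close>. The braid relation turns this into
  \<open>j - 1, j, j - 1\<close>, whose first letter commutes past the letters above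
  \<open>j\<close>.\<close>

lemma down_shift:
  assumes "Suc i < j" "j \<le> k" "k \<le> n"
  shows "pr (down k i @ [j]) = pr ((j - 1) # down k i)"
proof -
  obtain j' where j: "j = Suc j'" using assms by (cases j) auto
  have split: "down k i = down k j @ [j, j'] @ down (j' - 1) i"
  proof -
    have "[Suc i..<Suc k] = [Suc i..<j'] @ [j', j] @ [Suc j..<Suc k]"
      using assms j upt_add_eq_append[of "Suc i" j' "Suc k - j'"]
      by (simp add: upt_conv_Cons del: upt_Suc)
    then show ?thesis using assms j by simp
  qed
  let ?A = "pr (down k j)" and ?B = "pr (down (j' - 1) i)"
  have c: "?A \<in> carrier W" "?B \<in> carrier W" "s j \<in> carrier W" "s j' \<in> carrier W"
    using assms j by (auto intro!: s_closed pr_closed)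
  have B: "?B \<otimes> s j = s j \<otimes> ?B"
    using assms j by (intro pr_commute) (auto simp del: upt_Suc)
  have A: "?A \<otimes> s j' = s j' \<otimes> ?A"
    using assms j by (intro pr_commute) (auto simp del: upt_Suc)
  have "pr (down k i @ [j]) = ?A \<otimes> (s j \<otimes> (s j' \<otimes> (?B \<otimes> s j)))"
    unfolding split using assms j c by (subst pr_append; auto simp: pr_append m_assoc simp del: upt_Suc)+
  also have "\<dots> = ?A \<otimes> ((s j \<otimes> s j' \<otimes> s j) \<otimes> ?B)" using B c by (simp add: m_assoc)
  also have "s j \<otimes> s j' \<otimes> s j = s j' \<otimes> s j \<otimes> s j'" using s_braid[of j'] assms j by simp
  also have "?A \<otimes> (s j' \<otimes> s j \<otimes> s j' \<otimes> ?B) = (?A \<otimes> s j') \<otimes> (s j \<otimes> (s j' \<otimes> ?B))"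
    using c by (simp add: m_assoc)
  also have "\<dots> = s j' \<otimes> (?A \<otimes> (s j \<otimes> (s j' \<otimes> ?B)))" using A c by (simp add: m_assoc)
  also have "?A \<otimes> (s j \<otimes> (s j' \<otimes> ?B)) = pr (down k i)"
    unfolding split using assms j c by (subst pr_append; auto simp: pr_append m_assoc simp del: upt_Suc)+
  finally show ?thesis using j by simp
qed

text \<open>Letters are appended one by one to a normal form. The letter \<open>j = i\<close>
  lengthens the descending tail and \<open>j = i + 1\<close> cancels its last letter;
  \<open>j < i\<close> passes through the tail unchanged and \<open>j > i + 1\<close> passes as
  \<open>j - 1\<close>, both landing in \<open>{1..k}\<close>.\<close>

lemma normal_form:
  assumes "k < n" "set us \<subseteq> {1..Suc k}"
  shows "\<exists>vs i. set vs \<subseteq> {1..k} \<and> i \<le> Suc k \<and> pr us = pr (vs @ down (Suc k) i)"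
  using assms(2)
proof (induction us rule: rev_induct)
  case Nil
  show ?case by (intro exI[of _ "[]"] exI[of _ "Suc k"]) simp
next
  case (snoc j us)
  then obtain vs i where vs: "set vs \<subseteq> {1..k}" "i \<le> Suc k" "pr us = pr (vs @ down (Suc k) i)"
    by auto
  have j: "1 \<le> j" "j \<le> Suc k" using snoc by auto
  have sub: "set us \<subseteq> {1..n}" "set vs \<subseteq> {1..n}" "set (down (Suc k) i) \<subseteq> {1..n}" "j \<in> {1..n}"
    using assms snoc vs j by (auto simp del: upt_Suc)
  have c: "pr us \<in> carrier W" "pr vs \<in> carrier W" "pr (down (Suc k) i) \<in> carrier W" "s j \<in> carrier W"
    using sub pr_closed s_closed by blast+
  have eq: "pr (us @ [j]) = pr vs \<otimes> pr (down (Suc k) i @ [j])"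
    using vs(3) sub c by (simp add: pr_append m_assoc del: upt_Suc)
  consider "j = i" | "j = Suc i" | "j < i" | "Suc i < j" by linarith
  then show ?case
  proof cases
    case 1
    then have "down (Suc k) i @ [j] = down (Suc k) (i - 1)"
      using j by (simp add: upt_conv_Cons del: upt_Suc)
    then have "pr (us @ [j]) = pr (vs @ down (Suc k) (i - 1))"
      using eq sub(2) assms 1 j by (subst pr_append) (auto simp del: upt_Suc)
    moreover have "i - 1 \<le> Suc k" using 1 j by simp
    ultimately show ?thesis using vs(1) by blast
  next
    case 2
    then have d: "down (Suc k) i = down (Suc k) j @ [j]"
      using j by (simp add: upt_conv_Cons del: upt_Suc)
    have sd: "set (down (Suc k) j) \<subseteq> {1..n}" using assms by (auto simp del: upt_Suc)
    have "pr (down (Suc k) i @ [j]) = pr (down (Suc k) j)"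
      unfolding d using sub(4) sd pr_closed[OF sd] s_square[OF sub(4)] c(4)
      by (simp add: pr_append m_assoc del: upt_Suc)
    then have "pr (us @ [j]) = pr (vs @ down (Suc k) j)"
      using eq sub(2) sd by (simp add: pr_append del: upt_Suc)
    then show ?thesis using vs(1) j by blast
  next
    case 3
    then have "pr (down (Suc k) i) \<otimes> s j = s j \<otimes> pr (down (Suc k) i)"
      using sub(3,4) by (intro pr_commute) (auto simp del: upt_Suc)
    then have "pr (down (Suc k) i @ [j]) = pr (j # down (Suc k) i)"
      using sub(3,4) by (simp add: pr_snoc)
    then have "pr (us @ [j]) = pr ((vs @ [j]) @ down (Suc k) i)"
      using eq sub c by (simp add: pr_append m_assoc del: upt_Suc)
    moreover have "set (vs @ [j]) \<subseteq> {1..k}" using vs 3 j by auto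
    ultimately show ?thesis using vs(2) by blast
  next
    case 4
    then have "pr (down (Suc k) i @ [j]) = pr ((j - 1) # down (Suc k) i)"
      using down_shift[of i j "Suc k"] j assms by simp
    moreover have "j - 1 \<in> {1..n}" "s (j - 1) \<in> carrier W" using 4 j assms by (auto intro!: s_closed)
    ultimately have "pr (us @ [j]) = pr ((vs @ [j - 1]) @ down (Suc k) i)"
      using eq sub c by (simp add: pr_append m_assoc del: upt_Suc)
    moreover have "set (vs @ [j - 1]) \<subseteq> {1..k}" using vs 4 j by auto
    ultimately show ?thesis using vs(2) by blast
  qed
qed

lemma apply_adj_transps_fixes:
  "set us \<subseteq> {1..k} \<Longrightarrow> x > Suc k \<Longrightarrow> apply_adj_transps us x = x"
  by (induction us) (auto simp: transpose_apply_other)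

lemma apply_adj_transps_down:
  "i \<le> k \<Longrightarrow> apply_adj_transps (down k i) (Suc i) = Suc k"
  by (induction k rule: dec_induct) simp_all

text \<open>The kernel is trivial. Induction runs over the largest letter allowed, which the normal
  form confines to the descending tail.\<close>

lemma pr_eq_one:
  assumes "k \<le> n" "set us \<subseteq> {1..k}" "apply_adj_transps us = id"
  shows "pr us = \<one>"
  using assms
proof (induction k arbitrary: us)
  case 0
  then show ?case by simp
next
  case (Suc k)
  obtain vs i where vs: "set vs \<subseteq> {1..k}" "i \<le> Suc k" and eq: "pr us = pr (vs @ down (Suc k) i)"
    using normal_form[of k us] Suc.prems by auto
  have "apply_adj_transps (vs @ down (Suc k) i) = apply_adj_transps us"
    using Suc.prems vs by (intro pr_eq_imp_adj_transps_eq eq[symmetric]) (auto simp del: upt_Suc)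
  then have id: "apply_adj_transps vs (apply_adj_transps (down (Suc k) i) x) = x" for x
    using Suc.prems unfolding apply_adj_transps_append by (metis comp_apply id_apply)
  \<comment> \<open>The tail sends \<open>i + 1\<close> to \<open>k + 2\<close>, which
    \<open>vs\<close> fixes; so the identity forces \<open>i = k + 1\<close>, that is, an empty
    tail.\<close>
  have "Suc i = apply_adj_transps vs (Suc (Suc k))"
    using id[of "Suc i"] apply_adj_transps_down[OF vs(2)] by simp
  then have "i = Suc k"
    using apply_adj_transps_fixes[OF vs(1), of "Suc (Suc k)"] by simp
  then have "pr us = pr vs" "apply_adj_transps vs = id"
    using eq id by (auto simp: fun_eq_iff)
  then show ?case using Suc.IH[of vs] Suc.prems vs by simp
qed

text \<open>Reversing a word inverts it on both sides, so the trivial kernel applies to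
  \<open>rev vs @ us\<close>.\<close>

lemma adj_transps_eq_imp_pr_eq:
  assumes "set us \<subseteq> {1..n}" "set vs \<subseteq> {1..n}" "apply_adj_transps us = apply_adj_transps vs"
  shows "pr us = pr vs"
proof -
  have "apply_adj_transps (rev vs @ us) = id"
    using assms(3) apply_adj_transps_rev[of vs] by (simp add: apply_adj_transps_append)
  then have "pr (rev vs @ us) = \<one>" using pr_eq_one[of n] assms by simp
  then have "inv (pr vs) \<otimes> pr us = \<one>" using assms by (simp add: pr_append pr_rev)
  then show ?thesis
    using assms pr_closed by (metis inv_closed inv_equality inv_inv)
qed

section \<open>The isomorphism onto the symmetric group\<close>

definition perm_of :: "'a \<Rightarrow> nat \<Rightarrow> nat" where
  "perm_of w = apply_adj_transps (SOME us. set us \<subseteq> {1..n} \<and> pr us = w)"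

text \<open>The chosen word is irrelevant, since words with the same product give the same
  permutation.\<close>

lemma perm_of_pr: "set us \<subseteq> {1..n} \<Longrightarrow> perm_of (pr us) = apply_adj_transps us"
  unfolding perm_of_def
  by (rule someI2[where a = us]) (simp, blast intro: pr_eq_imp_adj_transps_eq)

lemma perm_of_mult:
  assumes "u \<in> carrier W" "v \<in> carrier W"
  shows "perm_of (u \<otimes> v) = perm_of u \<circ> perm_of v"
proof -
  obtain us vs where w: "set us \<subseteq> {1..n}" "pr us = u" "set vs \<subseteq> {1..n}" "pr vs = v"
    using assms words_cover_carrier by metis
  have "perm_of (pr (us @ vs)) = perm_of (pr us) \<circ> perm_of (pr vs)"
    using w by (subst (1 2 3) perm_of_pr) (auto simp: apply_adj_transps_append)
  then show ?thesis using w by (simp add: pr_append)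
qed

lemma bij_betw_perm_of: "bij_betw perm_of (carrier W) {p. p permutes {1..Suc n}}"
  unfolding bij_betw_def
proof (intro conjI equalityI subsetI inj_onI)
  fix u v assume *: "u \<in> carrier W" "v \<in> carrier W" "perm_of u = perm_of v"
  obtain us vs where w: "set us \<subseteq> {1..n}" "pr us = u" "set vs \<subseteq> {1..n}" "pr vs = v"
    using * words_cover_carrier by metis
  then have "apply_adj_transps us = apply_adj_transps vs" using *(3) perm_of_pr by metis
  then show "u = v" using adj_transps_eq_imp_pr_eq[of us vs] w by simp
next
  fix p assume "p \<in> perm_of ` carrier W"
  then obtain w where "w \<in> carrier W" "p = perm_of w" by blast
  then obtain us where "set us \<subseteq> {1..n}" "p = apply_adj_transps us"
    using words_cover_carrier perm_of_pr by metis
  then show "p \<in> {p. p permutes {1..Suc n}}" by (auto intro!: permutes_apply_adj_transps)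
next
  fix p assume "p \<in> {p. p permutes {1..Suc n}}"
  then obtain us where "set us \<subseteq> {1..n}" "p = apply_adj_transps us"
    using apply_adj_transps_words_surj by blast
  then show "p \<in> perm_of ` carrier W" using perm_of_pr pr_closed by (metis imageI)
qed

lemma perm_of_inv:
  assumes "v \<in> carrier W"
  shows "perm_of (inv v) = inv' (perm_of v)"
proof -
  have "perm_of \<one> = id" using perm_of_pr[of "[]"] by simp
  then have "perm_of (inv v) \<circ> perm_of v = id" "perm_of v \<circ> perm_of (inv v) = id"
    using perm_of_mult[of "inv v" v] perm_of_mult[of v "inv v"] assms by simp_all
  then show ?thesis by (metis inv_unique_comp)
qed

lemma finite_carrier: "finite (carrier W)"
  using bij_betw_finite[OF bij_betw_perm_of] finite_permutations[OF finite_atLeastAtMost] by metis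

section \<open>Length, ascents and descents\<close>

lemma word_of_gens:
  assumes "set xs \<subseteq> S"
  shows "\<exists>us. set us \<subseteq> {1..n} \<and> length us = length xs \<and> pr us = word_prod W xs"
proof -
  let ?us = "map (inv_into {1..n} s) xs"
  have *: "xs = map s ?us"
    using assms labelling by (auto simp: bij_betw_def f_inv_into_f intro!: map_idI[symmetric])
  moreover have "set ?us \<subseteq> {1..n}"
    using assms labelling unfolding bij_betw_def set_map by (blast intro: inv_into_into)
  ultimately show ?thesis unfolding pr_def by (metis length_map)
qed

lemma cox_length_le:
  assumes "set us \<subseteq> {1..n}"
  shows "cox_length W S (pr us) \<le> length us"
  unfolding cox_length_def
  by (rule Least_le, rule exI[of _ "map s us"]) (use map_s_in_S[OF assms] in \<open>simp add: pr_def\<close>)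

lemma reduced_word:
  assumes "w \<in> carrier W"
  shows "\<exists>us. set us \<subseteq> {1..n} \<and> pr us = w \<and> length us = cox_length W S w"
proof -
  obtain us where us: "set us \<subseteq> {1..n}" "pr us = w" using words_cover_carrier assms by blast
  have "\<exists>xs. set xs \<subseteq> S \<and> length xs = cox_length W S w \<and> word_prod W xs = w"
    unfolding cox_length_def
    by (rule LeastI[of _ "length us"], rule exI[of _ "map s us"])
      (use us map_s_in_S in \<open>simp add: pr_def\<close>)
  then show ?thesis using word_of_gens by metis
qed

lemma perm_of_mult_s:
  assumes "w \<in> carrier W" "i \<in> {1..n}"
  shows "perm_of (w \<otimes> s i) = perm_of w \<circ> transpose i (Suc i)"
  using perm_of_mult[OF assms(1) s_closed[OF assms(2)]] perm_of_pr[of "[i]"] assms(2)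
    s_closed[OF assms(2)] by simp

text \<open>The exchange property turns a reduced word of \<open>w\<close> into a shorter word with
  the permutation of \<open>w \<otimes> s i\<close>, hence with that product.\<close>

lemma cox_length_descent:
  assumes "w \<in> carrier W" "i \<in> {1..n}" "perm_of w i > perm_of w (Suc i)"
  shows "cox_length W S (w \<otimes> s i) < cox_length W S w"
proof -
  obtain us where us: "set us \<subseteq> {1..n}" "pr us = w" "length us = cox_length W S w"
    using reduced_word assms by blast
  then have p: "perm_of w = apply_adj_transps us" using perm_of_pr by blast
  obtain vs where vs: "length vs < length us" "set vs \<subseteq> set us"
    "apply_adj_transps vs = apply_adj_transps us \<circ> transpose i (Suc i)"
    using adj_transps_exchange[of us i] assms(3) unfolding p by blast
  have "pr vs = pr (us @ [i])"
    using us vs assms by (intro adj_transps_eq_imp_pr_eq) (auto simp: apply_adj_transps_append)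
  also have "\<dots> = w \<otimes> s i" using us assms s_closed by (simp add: pr_append)
  finally show ?thesis using cox_length_le[of vs] us vs by (metis order.strict_trans1 subset_trans)
qed

text \<open>If \<open>perm_of w\<close> increases at \<open>i\<close>, then
  \<open>w \<otimes> s i\<close> has a descent there, and multiplying by \<open>s i\<close> again
  returns to the shorter \<open>w\<close>.\<close>

lemma cox_length_ascent_iff:
  assumes "w \<in> carrier W" "i \<in> {1..n}"
  shows "cox_length W S (w \<otimes> s i) > cox_length W S w \<longleftrightarrow> perm_of w i < perm_of w (Suc i)"
proof -
  have "inj (perm_of w)"
    using bij_betw_perm_of assms(1) permutes_inj by (auto simp: bij_betw_def)
  then have "perm_of w i \<noteq> perm_of w (Suc i)" by (simp add: inj_eq)
  moreover have "w \<otimes> s i \<otimes> s i = w" using assms s_closed s_square by (simp add: m_assoc)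
  ultimately show ?thesis
    using cox_length_descent[OF assms] cox_length_descent[of "w \<otimes> s i" i] assms
      perm_of_mult_s[OF assms] s_closed[OF assms(2)]
    by (cases "perm_of w i < perm_of w (Suc i)") auto
qed

text \<open>Ascents at \<open>j\<close> consecutive generators compare \<open>j + 1\<close> points,
  whence \<open>Suc j\<close>.\<close>

lemma X_set_eq:
  assumes "j \<le> n"
  shows "X_set W S (s ` {1..j}) = {w \<in> carrier W. strict_mono_on {1..Suc j} (perm_of w)}"
proof -
  have "cox_length W S (w \<otimes> s i) > cox_length W S w \<longleftrightarrow> perm_of w i < perm_of w (Suc i)"
    if "w \<in> carrier W" "i \<in> {1..j}" for w i
    using cox_length_ascent_iff[OF that(1), of i] that(2) assms by auto
  then show ?thesis unfolding X_set_def strict_mono_on_iff_Suc by auto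
qed

end

subsection \<open>Products in the group algebra\<close>

lemma lookup_sum_ga_elem:
  assumes "finite A"
  shows "Poly_Mapping.lookup (\<Sum>w\<in>A. ga_elem w) x = of_bool (x \<in> A)"
  using assms by (simp add: lookup_sum ga_elem_def lookup_single when_def)

lemma keys_sum_ga_elem:
  assumes "finite A"
  shows "Poly_Mapping.keys (\<Sum>w\<in>A. ga_elem w) = A"
  using assms by (auto simp: lookup_sum_ga_elem in_keys_iff)

text \<open>All nonzero coefficients of the factors are 1, so each factorization of \<open>w\<close>
  contributes 1.\<close>

lemma lookup_ga_mult_sum_ga_elem:
  assumes "finite A" "finite B"
  shows "Poly_Mapping.lookup (ga_mult W (\<Sum>u\<in>A. ga_elem u) (\<Sum>v\<in>B. ga_elem v)) w =
    of_nat (card {(u, v) \<in> A \<times> B. u \<otimes>\<^bsub>W\<^esub> v = w})"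
proof -
  have "ga_mult W (\<Sum>u\<in>A. ga_elem u) (\<Sum>v\<in>B. ga_elem v) =
      (\<Sum>u\<in>A. \<Sum>v\<in>B. Poly_Mapping.single (u \<otimes>\<^bsub>W\<^esub> v) 1)"
    unfolding ga_mult_def keys_sum_ga_elem[OF assms(1)] keys_sum_ga_elem[OF assms(2)]
    using assms by (intro sum.cong HOL.refl) (simp add: lookup_sum_ga_elem)
  then have "Poly_Mapping.lookup (ga_mult W (\<Sum>u\<in>A. ga_elem u) (\<Sum>v\<in>B. ga_elem v)) w =
      (\<Sum>u\<in>A. \<Sum>v\<in>B. of_bool (u \<otimes>\<^bsub>W\<^esub> v = w))"
    by (simp add: lookup_sum lookup_single when_def of_bool_def)
  also have "\<dots> = (\<Sum>x\<in>A \<times> B. of_bool (fst x \<otimes>\<^bsub>W\<^esub> snd x = w))"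
    by (simp add: sum.cartesian_product case_prod_unfold)
  also have "\<dots> = of_nat (card {x \<in> A \<times> B. fst x \<otimes>\<^bsub>W\<^esub> snd x = w})"
    using assms by (simp add: Int_def)
  finally show ?thesis by (simp add: case_prod_unfold mem_Times_iff)
qed

lemma lookup_ga_scale: "Poly_Mapping.lookup (ga_scale c f) w = c * Poly_Mapping.lookup f w"
  by (simp add: ga_scale_def map.rep_eq when_def)

section \<open>Coefficients of the product as numbers of factorizations\<close>

context coxeter_system_type_A
begin

text \<open>The index is the number \<open>c = l + 1\<close> of points. Both \<open>c = 0\<close>
  and \<open>c = 1\<close> give the whole group, matching the convention
  \<open>x_(-1) = x_0\<close>.\<close>

definition incr_set :: "nat \<Rightarrow> 'a set" where
  "incr_set c = {w \<in> carrier W. strict_mono_on {1..c} (perm_of w)}"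

lemma finite_incr_set: "finite (incr_set c)"
  unfolding incr_set_def using finite_carrier by simp

lemma x_A_eq:
  assumes "c \<le> Suc n"
  shows "x_A W S s (int c - 1) = (\<Sum>w\<in>incr_set c. ga_elem w)"
proof (cases c)
  case 0
  then show ?thesis by (simp add: x_A_def x_elem_def X_set_def incr_set_def strict_mono_on_def)
next
  case (Suc j)
  then show ?thesis using assms X_set_eq[of j]
    by (simp add: x_A_def x_elem_def incr_set_def)
qed

text \<open>A factorization is determined by \<open>v\<close>, with
  \<open>u = w \<otimes> inv v\<close>; \<open>perm_of\<close> carries the condition on
  \<open>v\<close> to the permutations counted before.\<close>

lemma card_products:
  assumes "w \<in> carrier W" "a \<le> Suc n" "b \<le> Suc n"
  shows "card {(u, v) \<in> incr_set a \<times> incr_set b. u \<otimes> v = w} =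
    (\<Sum>c | c \<le> min a b \<and> w \<in> incr_set c.
      ((Suc n - a) choose (b - c)) * ((Suc n - b) choose (a - c)) * fact (Suc n - b - (a - c)))"
proof -
  let ?V = "{v \<in> carrier W. strict_mono_on {1..b} (perm_of v) \<and> strict_mono_on {1..a} (perm_of w \<circ> inv' (perm_of v))}"
  have "bij_betw (\<lambda>v. (w \<otimes> inv v, v)) ?V {(u, v) \<in> incr_set a \<times> incr_set b. u \<otimes> v = w}"
  proof (rule bij_betwI[where g = snd])
    show "(\<lambda>v. (w \<otimes> inv v, v)) \<in> ?V \<rightarrow> {(u, v) \<in> incr_set a \<times> incr_set b. u \<otimes> v = w}"
      using assms(1) by (auto simp: incr_set_def perm_of_mult perm_of_inv m_assoc)
    have *: "w \<otimes> inv v = u" if "u \<in> carrier W" "v \<in> carrier W" "u \<otimes> v = w" for u v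
      using that by (metis inv_solve_right m_closed)
    show "snd \<in> {(u, v) \<in> incr_set a \<times> incr_set b. u \<otimes> v = w} \<rightarrow> ?V"
    proof
      fix x assume "x \<in> {(u, v) \<in> incr_set a \<times> incr_set b. u \<otimes> v = w}"
      then obtain u v where x: "x = (u, v)" "u \<in> incr_set a" "v \<in> incr_set b" "u \<otimes> v = w" by auto
      then have c: "u \<in> carrier W" "v \<in> carrier W" by (auto simp: incr_set_def)
      have "perm_of u = perm_of w \<circ> inv' (perm_of v)"
        using *[OF c x(4)] perm_of_mult[OF assms(1) inv_closed[OF c(2)]] perm_of_inv[OF c(2)] by simp
      then show "snd x \<in> ?V" using x by (simp add: incr_set_def)
    qed
    show "(w \<otimes> inv (snd x), snd x) = x"
      if "x \<in> {(u, v) \<in> incr_set a \<times> incr_set b. u \<otimes> v = w}" for x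
      using that * by (auto simp: incr_set_def)
  qed simp
  moreover have "bij_betw perm_of ?V {q \<in> {q. q permutes {1..Suc n}}.
      strict_mono_on {1..b} q \<and> strict_mono_on {1..a} (perm_of w \<circ> inv' q)}"
    by (rule bij_betw_Collect[OF bij_betw_perm_of]) simp
  ultimately have "card {(u, v) \<in> incr_set a \<times> incr_set b. u \<otimes> v = w} =
    card {q. q permutes {1..Suc n} \<and> strict_mono_on {1..b} q \<and> strict_mono_on {1..a} (perm_of w \<circ> inv' q)}"
    by (auto dest!: bij_betw_same_card)
  moreover have "perm_of w permutes {1..Suc n}"
    using bij_betw_perm_of assms(1) by (auto simp: bij_betw_def)
  ultimately show ?thesis
    using card_permutations_incr[of "perm_of w" "Suc n" a b] assms by (simp add: incr_set_def)
qed

end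

text \<open>With \<open>l = c - 1\<close>, integer and truncated subtraction agree unless the
  factorial has a negative argument. Then the left side is 0 by definition, and on the right
  \<open>(n - k) choose (Suc j - c)\<close> vanishes.\<close>

lemma coeff_A_eq:
  assumes "j \<le> n" "k \<le> n" "c \<le> min (Suc j) (Suc k)"
  shows "coeff_A n j k (int c - 1) =
    ((n - j) choose (Suc k - c)) * ((n - k) choose (Suc j - c)) * fact (n - k - (Suc j - c))"
proof (cases "n - k < Suc j - c")
  case True
  then show ?thesis using assms by (auto simp: coeff_A_def)
next
  case False
  have "nat (int k - (int c - 1)) = Suc k - c" "nat (int j - (int c - 1)) = Suc j - c"
    "nat (int n - int j - int k + (int c - 1)) = n - k - (Suc j - c)"
    using assms False by auto
  moreover have "\<not> int n - int j - int k + (int c - 1) < 0" using assms False by auto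
  ultimately show ?thesis unfolding coeff_A_def by simp
qed

theorem corollary3p5:
  fixes W (structure) and S :: "'a set" and s :: "nat \<Rightarrow> 'a" and n j k :: nat
  assumes "coxeter_system_type_A W S s n"
    and "n \<ge> 1" and "j \<le> n" and "k \<le> n"
  shows "ga_mult W (x_A W S s (int j)) (x_A W S s (int k)) =
    (\<Sum>l = -1..int (min j k). ga_scale (of_nat (coeff_A n j k l)) (x_A W S s l))"
proof -
  interpret coxeter_system_type_A W S s n by fact
  let ?m = "min (Suc j) (Suc k)"
  let ?c = "\<lambda>c. ((n - j) choose (Suc k - c)) * ((n - k) choose (Suc j - c)) * fact (n - k - (Suc j - c))"
  have x: "x_A W S s (int i) = (\<Sum>w\<in>incr_set (Suc i). ga_elem w)" if "i \<le> n" for i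
    using x_A_eq[of "Suc i"] that by simp
  \<comment> \<open>Substituting \<open>l = c - 1\<close> moves the lower limit from -1 to
    0.\<close>
  have "bij_betw (\<lambda>c. int c - 1) {..?m} {-1..int (min j k)}"
    by (rule bij_betwI[where g = "\<lambda>l. nat (l + 1)"]) auto
  from sum.reindex_bij_betw[OF this, of "\<lambda>l. ga_scale (of_nat (coeff_A n j k l)) (x_A W S s l)"]
  have rhs: "(\<Sum>l = -1..int (min j k). ga_scale (of_nat (coeff_A n j k l)) (x_A W S s l)) =
      (\<Sum>c\<le>?m. ga_scale (of_nat (coeff_A n j k (int c - 1))) (x_A W S s (int c - 1)))"
    by (rule HOL.sym)
  also have "\<dots> = (\<Sum>c\<le>?m. ga_scale (of_nat (?c c)) (\<Sum>w\<in>incr_set c. ga_elem w))"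
  proof (rule sum.cong[OF HOL.refl])
    fix c assume "c \<in> {..?m}"
    then have c: "c \<le> ?m" "c \<le> Suc n" using assms by auto
    show "ga_scale (of_nat (coeff_A n j k (int c - 1))) (x_A W S s (int c - 1)) =
        ga_scale (of_nat (?c c)) (\<Sum>w\<in>incr_set c. ga_elem w)"
      unfolding coeff_A_eq[OF assms(3,4) c(1)] x_A_eq[OF c(2)] ..
  qed
  finally have rhs: "(\<Sum>l = -1..int (min j k). ga_scale (of_nat (coeff_A n j k l)) (x_A W S s l)) = \<dots>" .
  show ?thesis unfolding rhs x[OF assms(3)] x[OF assms(4)]
  proof (rule poly_mapping_eqI)
    fix w
    let ?P = "{(u, v) \<in> incr_set (Suc j) \<times> incr_set (Suc k). u \<otimes> v = w}"
    have "Poly_Mapping.lookup (\<Sum>c\<le>?m. ga_scale (of_nat (?c c)) (\<Sum>w\<in>incr_set c. ga_elem w)) w =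
        (\<Sum>c\<le>?m. of_nat (?c c) * of_bool (w \<in> incr_set c))"
      unfolding lookup_sum[of _ "{..?m}"] lookup_ga_scale lookup_sum_ga_elem[OF finite_incr_set] ..
    also have "\<dots> = of_nat (\<Sum>c | c \<le> ?m \<and> w \<in> incr_set c. ?c c)"
      unfolding of_nat_sum
      by (rule sum.mono_neutral_cong_right) auto
    also have "(\<Sum>c | c \<le> ?m \<and> w \<in> incr_set c. ?c c) = card ?P"
    proof (cases "w \<in> carrier W")
      case True
      then show ?thesis
        using card_products[of w "Suc j" "Suc k"] assms by simp
    next
      case False
      \<comment> \<open>Outside the carrier both coefficients are 0, as products of group elements
        stay inside it.\<close>
      then have none: "w \<notin> incr_set c" for c by (simp add: incr_set_def)
      have "?P = {}" using False by (auto simp: incr_set_def)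
      show ?thesis unfolding \<open>?P = {}\<close> using none by simp
    qed
    finally show "Poly_Mapping.lookup (ga_mult W (\<Sum>w\<in>incr_set (Suc j). ga_elem w) (\<Sum>w\<in>incr_set (Suc k). ga_elem w)) w =
        Poly_Mapping.lookup (\<Sum>c\<le>?m. ga_scale (of_nat (?c c)) (\<Sum>w\<in>incr_set c. ga_elem w)) w"
      using lookup_ga_mult_sum_ga_elem[OF finite_incr_set finite_incr_set] by metis
  qed
qed

end
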